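(* Let $n\ge 4$ and let $P\subset\mathbb{R}^{n-1}$ be a bounded convex polyhedron without sectional projections. Define $K:=P\times[0,+\infty[\ \subset\mathbb{R}^n$. Then $K$ can be placed neither in first trimming position with respect to any of its facets nor in second trimming position with respect to any of its unbounded facets.
   Context: A convex polyhedron in $\mathbb{R}^n$ is a finite intersection of closed affine half-spaces. Its faces are its intersections with supporting hyperplanes; facets of an $n$-dimensional polyhedron in $\mathbb{R}^n$ are its $(n-1)$-dimensional faces. A bounded convex polyhedron $P\subset\mathbb{R}^m$ of dimension $m$ is said to be without sectional projections if for each line (through the origin) $\vec{\ell}\subset\mathbb{R}^m$ and each affine hyperplane $H\subset\mathbb{R}^m$ non-parallel to $\vec{\ell}$ one has $\pi(P)\neq P\cap H$, where $\pi:\mathbb{R}^m\to H$ is the projection onto $H$ in the direction of $\vec{\ell}$. Here $m=n-1$. Let $\pi_n:\mathbb{R}^n\to\mathbb{R}^{n-1}\times\{0\}$, $(x_1,\dots,x_n)\mapsto(x_1,\dots,x_{n-1},0)$. For a convex polyhedron $K\subset\mathbb{R}^n$ and $a\in\mathbb{R}^{n-1}$ put $I_a:=\pi_n^{-1}(a,0)\cap K$ and $\mathfrak{A}_K:=\{a\in\mathbb{R}^{n-1}:\ I_a\neq\varnothing,\ (a,0)\notin I_a\}$. An $n$-dimensional convex polyhedron $K\subset\mathbb{R}^n$ with a facet $F$ is in first trimming position with respect to $F$ if: (1) $F\subset\{x_{n-1}=0\}$ and $K\subset\{x_{n-1}\le 0\}$; (2) for all $a\in\mathbb{R}^{n-1}$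 the interval $I_a$ is bounded; (3) $\mathfrak{A}_K$ is bounded. It is in second trimming position with respect to $F$ if: (1) $F\subset\{x_n=0\}$ and $K\subset\{x_n\le 0\}$; (2) $\mathfrak{A}_K$ is bounded. "$K$ can be placed in first (resp. second) trimming position with respect to $F$" means that there is an affine bijection $\phi:\mathbb{R}^n\to\mathbb{R}^n$ such that $\phi(K)$ is in first (resp. second) trimming position with respect to its facet $\phi(F)$. *)

theory Defs
  imports "HOL-Analysis.Analysis"
begin

text \<open>
  With m = n - 1, the space of dimension n is \<open>(real ^ 'm) \<times> real\<close>: the coordinate n of x is
  \<open>snd x\<close>. The index type \<open>'m\<close> is linearly ordered so that "the last coordinate" of
  \<open>real ^ 'm\<close>, i.e. the coordinate n - 1 of x, makes sense.
\<close>

definition coord_n :: "(real ^ 'm) \<times> real \<Rightarrow> real" where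
  "coord_n x = snd x"

definition coord_pred_n :: "(real ^ 'm::{finite,linorder}) \<times> real \<Rightarrow> real" where
  "coord_pred_n x = fst x $ Max UNIV"

text \<open>
  Projection in the direction of the line \<open>span {v}\<close> onto the hyperplane \<open>{x. u \<bullet> x = c}\<close>,
  which is non-parallel to the line iff \<open>u \<bullet> v \<noteq> 0\<close>; see \<open>hyperplane_proj_iff\<close>.
\<close>

definition hyperplane_proj :: "'a::euclidean_space \<Rightarrow> 'a \<Rightarrow> real \<Rightarrow> 'a \<Rightarrow> 'a" where
  "hyperplane_proj v u c x = x - ((u \<bullet> x - c) / (u \<bullet> v)) *\<^sub>R v"

lemma hyperplane_proj_iff:
  assumes "u \<bullet> v \<noteq> 0"
  shows "hyperplane_proj v u c x = y \<longleftrightarrow> u \<bullet> y = c \<and> x - y \<in> span {v}"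
proof
  assume "hyperplane_proj v u c x = y"
  then have y: "y = x - ((u \<bullet> x - c) / (u \<bullet> v)) *\<^sub>R v"
    by (simp add: hyperplane_proj_def)
  show "u \<bullet> y = c \<and> x - y \<in> span {v}"
    using assms unfolding y by (simp add: inner_diff_right span_breakdown_eq)
next
  assume *: "u \<bullet> y = c \<and> x - y \<in> span {v}"
  then obtain t where "x - y = t *\<^sub>R v"
    by (auto simp: span_singleton)
  then have x: "x = y + t *\<^sub>R v"
    by (simp add: algebra_simps)
  show "hyperplane_proj v u c x = y"
    using * assms unfolding x by (simp add: hyperplane_proj_def inner_add_right)
qed

definition without_sectional_projections :: "'a::euclidean_space set \<Rightarrow> bool" where
  "without_sectional_projections P \<longleftrightarrow>
     polyhedron P \<and> bounded P \<and> aff_dim P = int DIM('a) \<and>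
     (\<forall>v u c. v \<noteq> 0 \<longrightarrow> u \<noteq> 0 \<longrightarrow> u \<bullet> v \<noteq> 0 \<longrightarrow>
        hyperplane_proj v u c ` P \<noteq> P \<inter> {x. u \<bullet> x = c})"

definition proj_n :: "(real ^ 'm) \<times> real \<Rightarrow> (real ^ 'm) \<times> real" where
  "proj_n x = (fst x, 0)"

definition fibre :: "((real ^ 'm) \<times> real) set \<Rightarrow> real ^ 'm \<Rightarrow> ((real ^ 'm) \<times> real) set" where
  "fibre K a = proj_n -` {(a, 0)} \<inter> K"

definition frak_A :: "((real ^ 'm) \<times> real) set \<Rightarrow> (real ^ 'm) set" where
  "frak_A K = {a. fibre K a \<noteq> {} \<and> (a, 0) \<notin> fibre K a}"

text \<open>
  For polyhedra, \<^const>\<open>face_of\<close> and \<^const>\<open>exposed_face_of\<close> agree, so \<^const>\<open>facet_of\<close> gives the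
  intersections with supporting hyperplanes that have codimension one in the polyhedron.
  This predicate collects the standing hypotheses of both trimming positions; they are
  invariant under affine bijections.
\<close>

definition full_polyhedron_with_facet :: "'a::euclidean_space set \<Rightarrow> 'a set \<Rightarrow> bool" where
  "full_polyhedron_with_facet K F \<longleftrightarrow>
     polyhedron K \<and> aff_dim K = int DIM('a) \<and> F facet_of K"

definition first_trimming_position ::
  "((real ^ 'm::{finite,linorder}) \<times> real) set \<Rightarrow> ((real ^ 'm::{finite,linorder}) \<times> real) set \<Rightarrow> bool" where
  "first_trimming_position K F \<longleftrightarrow>
     full_polyhedron_with_facet K F \<and>
     F \<subseteq> {x. coord_pred_n x = 0} \<and> K \<subseteq> {x. coord_pred_n x \<le> 0} \<and>
     (\<forall>a. bounded (fibre K a)) \<and>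
     bounded (frak_A K)"

definition second_trimming_position ::
  "((real ^ 'm) \<times> real) set \<Rightarrow> ((real ^ 'm) \<times> real) set \<Rightarrow> bool" where
  "second_trimming_position K F \<longleftrightarrow>
     full_polyhedron_with_facet K F \<and>
     F \<subseteq> {x. coord_n x = 0} \<and> K \<subseteq> {x. coord_n x \<le> 0} \<and>
     bounded (frak_A K)"

definition affine_bijection :: "('a::real_vector \<Rightarrow> 'a) \<Rightarrow> bool" where
  "affine_bijection \<phi> \<longleftrightarrow> bij \<phi> \<and> (\<exists>f b. linear f \<and> \<phi> = (\<lambda>x. f x + b))"

definition can_be_placed_first ::
  "((real ^ 'm::{finite,linorder}) \<times> real) set \<Rightarrow> ((real ^ 'm::{finite,linorder}) \<times> real) set \<Rightarrow> bool" where
  "can_be_placed_first K F \<longleftrightarrow>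
     (\<exists>\<phi>. affine_bijection \<phi> \<and> first_trimming_position (\<phi> ` K) (\<phi> ` F))"

definition can_be_placed_second ::
  "((real ^ 'm) \<times> real) set \<Rightarrow> ((real ^ 'm) \<times> real) set \<Rightarrow> bool" where
  "can_be_placed_second K F \<longleftrightarrow>
     (\<exists>\<phi>. affine_bijection \<phi> \<and> second_trimming_position (\<phi> ` K) (\<phi> ` F))"

end

theory Submission
  imports Defs
begin

text \<open>
  Let \<open>d\<close> be the image of the recession direction \<open>(0, 1)\<close> of \<open>P \<times> [0, \<infinity>[\<close> under the linear part
  of the placing map. If \<open>d\<close> is transversal to \<open>{x\<^sub>n = 0}\<close>, the placed prism meets this hyperplane in
  a bounded set; then its unbounded facets do not lie there and, unless \<open>d\<close> is vertical (so that
  some \<open>I\<^sub>a\<close> is unbounded), \<open>\<AA>\<close> contains almost all of a ray. If \<open>d\<close> is parallel to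
  \<open>{x\<^sub>n = 0}\<close>, every ray in direction \<open>d\<close> has to leave the bounded set \<open>\<AA>\<close>, so that the full
  cylinder contains its vertical projection to \<open>{x\<^sub>n = 0}\<close>. Dividing out \<open>d\<close>, this is
  a sectional projection of \<open>P\<close>.
\<close>

lemma bounded_contains_ray_imp:
  fixes x d :: "'a::real_normed_vector"
  assumes "bounded S" and ray: "\<And>t. t \<ge> 0 \<Longrightarrow> x + t *\<^sub>R d \<in> S"
  shows "d = 0"
proof (rule ccontr)
  assume d: "d \<noteq> 0"
  obtain B where B: "\<And>y. y \<in> S \<Longrightarrow> norm y \<le> B"
    using \<open>bounded S\<close> by (auto simp: bounded_iff)
  \<comment> \<open>Chosen so that \<open>t *\<^sub>R d\<close> has norm
    \<open>B + norm x + 1\<close>, too long for a difference of \<open>x\<close> and a point of norm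
    at most \<open>B\<close>.\<close>
  define t where "t = (B + norm x + 1) / norm d"
  have "0 \<le> B"
    using order_trans[OF norm_ge_zero B[OF ray[of 0]]] by simp
  then have "t \<ge> 0"
    by (simp add: t_def)
  then have "norm (x + t *\<^sub>R d) \<le> B"
    using B ray by blast
  moreover have "norm (t *\<^sub>R d) = B + norm x + 1"
    using d \<open>0 \<le> B\<close> by (simp add: t_def)
  moreover have "norm (t *\<^sub>R d) \<le> norm (x + t *\<^sub>R d) + norm x"
    using norm_triangle_ineq4[of "x + t *\<^sub>R d" x] by simp
  ultimately show False
    by linarith
qed

lemma mem_frak_A_iff: "a \<in> frak_A K \<longleftrightarrow> a \<in> fst ` K \<and> (a, 0) \<notin> K"
  by (force simp: frak_A_def fibre_def proj_n_def)

lemma linear_prod_line: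
  fixes f :: "'a::real_vector \<times> real \<Rightarrow> 'b::real_vector"
  assumes "linear f"
  shows "f (y, s) = f (y, 0) + s *\<^sub>R f (0, 1)"
  using linear_add[OF assms, of "(y, 0)" "s *\<^sub>R (0, 1)"]
    linear_scale[OF assms, of s "(0, 1)"] by simp

text \<open>As \<open>g\<close> is not constant along \<open>(0, 1)\<close>, the line over each
  \<open>y\<close> meets the level set at exactly one height, which is an affine function of
  \<open>y\<close> and hence bounded on \<open>P\<close>.\<close>

lemma bounded_transversal_section:
  fixes g :: "'a::euclidean_space \<times> real \<Rightarrow> real"
  assumes "linear g" and "g (0, 1) \<noteq> 0" and "bounded P"
  shows "bounded {x \<in> P \<times> UNIV. g x = c}"
proof -
  have bl: "bounded_linear (\<lambda>y. g (y, 0))"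
    unfolding linear_conv_bounded_linear[symmetric]
    using linear_compose[OF _ \<open>linear g\<close>, of "\<lambda>y. (y, 0)"] by (simp add: comp_def linear_iff)
  define h where "h y = (c - g (y, 0)) / g (0, 1)" for y
  have "bounded ((\<lambda>y. g (y, 0)) ` P)"
    using bounded_linear_image[OF \<open>bounded P\<close> bl] .
  then have "bounded ((\<lambda>z. (1 / g (0, 1)) *\<^sub>R z) ` (+) c ` uminus ` (\<lambda>y. g (y, 0)) ` P)"
    by (intro bounded_scaling bounded_translation) (simp add: bounded_uminus)
  then have "bounded (h ` P)"
    by (simp add: image_image h_def)
  moreover have "{x \<in> P \<times> UNIV. g x = c} \<subseteq> P \<times> h ` P"
  proof
    fix x
    assume x: "x \<in> {x \<in> P \<times> UNIV. g x = c}"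
    obtain y s where ys: "x = (y, s)"
      by (rule prod.exhaust)
    with x have "y \<in> P" and "c = g (y, s)"
      by simp_all
    then have "s = h y"
      using assms(2) linear_prod_line[OF \<open>linear g\<close>, of y s] by (simp add: h_def)
    with \<open>y \<in> P\<close> show "x \<in> P \<times> h ` P" by (simp add: ys)
  qed
  ultimately show ?thesis
    using \<open>bounded P\<close> bounded_Times bounded_subset by blast
qed

lemma without_sectional_projections_imp_nonempty:
  "without_sectional_projections P \<Longrightarrow> P \<noteq> {}"
  by (auto simp: without_sectional_projections_def)

lemma affine_bijectionE:
  assumes "affine_bijection \<phi>"
  obtains f b where "linear f" and "bij f" and "\<phi> = (\<lambda>x. f x + b)"
proof -
  obtain f b where f: "linear f" "\<phi> = (\<lambda>x. f x + b)" and "bij \<phi>"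
    using assms by (auto simp: affine_bijection_def)
  then have "f = (\<lambda>x. x - b) \<circ> \<phi>"
    by (simp add: comp_def)
  moreover have "bij (\<lambda>x. x - b)"
    by (rule bij_betw_byWitness[where f' = "\<lambda>x. x + b"]) auto
  ultimately have "bij f"
    using \<open>bij \<phi>\<close> bij_comp by blast
  with f that show thesis by blast
qed

text \<open>The parallel case, argued by contradiction: boundedness would yield \<open>v\<close>,
  \<open>u\<close>, \<open>c\<close> for which the projection of \<open>P\<close> is a section of
  \<open>P\<close>. Since \<open>f (0, 1)\<close> has last coordinate 0, the last coordinate of
  \<open>f (y, s)\<close> does not depend on \<open>s\<close>, so the data descend to the base space
  of \<open>P\<close>.\<close>

lemma unbounded_frak_A_if_parallel:
  fixes P :: "(real ^ 'm) set" and f :: "(real ^ 'm) \<times> real \<Rightarrow> (real ^ 'm) \<times> real"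
  assumes P: "without_sectional_projections P"
    and f: "linear f" "bij f"
    and parallel: "snd (f (0, 1)) = 0"
  shows "\<not> bounded (frak_A ((\<lambda>x. f x + b) ` (P \<times> {0..})))" (is "\<not> bounded (frak_A ?K)")
proof
  assume bdd: "bounded (frak_A ?K)"
  have inj: "f x = f y \<Longrightarrow> x = y" for x y
    using \<open>bij f\<close> by (metis bij_pointE)
  have line: "f (y, s) = f (y, 0) + s *\<^sub>R f (0, 1)" for y s
    by (rule linear_prod_line[OF \<open>linear f\<close>])
  have f0: "f (0, 0) = 0"
    using linear_0[OF \<open>linear f\<close>] by (simp add: zero_prod_def)
  \<comment> \<open>Pulls the vertical direction back through \<open>f\<close>; dividing out
    \<open>(0, 1)\<close> leaves \<open>v\<close> as the direction of the sectional
    projection.\<close>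
  obtain v r where v: "f (v, r) = (0, 1)"
    using \<open>bij f\<close> by (metis bij_pointE surj_pair)
  define g where "g y = snd (f (y, 0))" for y
  have "linear g"
    unfolding g_def
    using linear_compose[OF linear_compose[OF _ \<open>linear f\<close>] linear_snd, of "\<lambda>y. (y, 0)"]
    by (simp add: comp_def linear_iff)
  \<comment> \<open>The vector that represents the functional \<open>g\<close> by the inner product;
    it becomes the normal of the hyperplane.\<close>
  define u where "u = adjoint g 1"
  have u: "u \<bullet> y = g y" for y
    using adjoint_works[OF \<open>linear g\<close>, of y 1] by (simp add: u_def inner_commute)
  have snd_f: "snd (f (y, s)) = u \<bullet> y" for y s
    using line[of y s] parallel by (simp add: u g_def)
  \<comment> \<open>With this level, \<open>u \<bullet> y = c\<close> says that the whole line over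
    \<open>y\<close> is placed in the hyperplane of last coordinate 0.\<close>
  define c where "c = - snd b"
  have uv: "u \<bullet> v = 1"
    using snd_f[of v r] v by simp
  have fst_d: "fst (f (0, 1)) \<noteq> 0"
    using inj[of "(0, 1)" "(0, 0)"] parallel f0 by (auto simp: prod_eq_iff)
  have proj: "hyperplane_proj v u c y \<in> P" if y: "y \<in> P" for y
  proof -
    \<comment> \<open>The horizontal shadow of the ray over \<open>y\<close> is itself a ray. Where
      it leaves the bounded set, the fibre is still nonempty, so its point at height 0 must belong
      to the placed prism.\<close>
    have "\<exists>t\<ge>0. fst (f (y, 0) + b) + t *\<^sub>R fst (f (0, 1)) \<notin> frak_A ?K"
      using bounded_contains_ray_imp[OF bdd] fst_d by blast
    moreover have "fst (f (y, t) + b) = fst (f (y, 0) + b) + t *\<^sub>R fst (f (0, 1))" for t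
      using arg_cong[OF line[of y t], of fst] by simp
    ultimately obtain t where t: "t \<ge> 0" "fst (f (y, t) + b) \<notin> frak_A ?K"
      by metis
    then have "(fst (f (y, t) + b), 0) \<in> ?K"
      using y by (force simp: mem_frak_A_iff)
    then obtain x where x: "x \<in> P \<times> {0..}" "(fst (f (y, t) + b), 0) = f x + b"
      by (rule imageE)
    obtain q s where "x = (q, s)"
      by (rule prod.exhaust)
    with x have q: "q \<in> P" "f (q, s) + b = (fst (f (y, t) + b), 0)"
      by simp_all
    \<comment> \<open>The placed points of \<open>(y, t)\<close> and \<open>(q, s)\<close> differ by
      \<open>k\<close> times the vertical unit vector, so their preimages differ by
      \<open>k *\<^sub>R (v, r)\<close>; the height component is then discarded.\<close>
    define k where "k = snd (f (y, t) + b)"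
    have "f ((y, t) - (q, s)) = f (y, t) - f (q, s)"
      by (rule linear_diff[OF \<open>linear f\<close>])
    also have "\<dots> = (f (y, t) + b) - (f (q, s) + b)"
      by simp
    also have "\<dots> = k *\<^sub>R (0, 1)"
      unfolding q k_def by (simp add: prod_eq_iff)
    also have "\<dots> = f (k *\<^sub>R (v, r))"
      using v linear_scale[OF \<open>linear f\<close>, of k "(v, r)"] by simp
    finally have "y - q = k *\<^sub>R v"
      using inj by fastforce
    then have "y - q \<in> span {v}"
      by (auto simp: span_singleton)
    moreover have "u \<bullet> q = c"
      using arg_cong[OF q(2), of snd] snd_f[of q s] by (simp add: c_def)
    ultimately have "hyperplane_proj v u c y = q"
      using uv by (subst hyperplane_proj_iff) auto
    with q show ?thesis by simp
  qed
  have on_plane: "u \<bullet> hyperplane_proj v u c y = c" for y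
    using hyperplane_proj_iff[of u v c y] uv by auto
  have fixed: "hyperplane_proj v u c y = y" if "u \<bullet> y = c" for y
    using that by (simp add: hyperplane_proj_def)
  \<comment> \<open>The projection maps \<open>P\<close> into its section and fixes the section
    pointwise.\<close>
  have "hyperplane_proj v u c ` P = P \<inter> {x. u \<bullet> x = c}"
    using proj on_plane fixed by (auto intro!: rev_image_eqI)
  moreover have "v \<noteq> 0" "u \<noteq> 0" "u \<bullet> v \<noteq> 0"
    using uv by auto
  ultimately show False
    using P by (auto simp: without_sectional_projections_def)
qed

lemma fibre_unbounded_or_frak_A_unbounded:
  fixes P :: "(real ^ 'm) set" and f :: "(real ^ 'm) \<times> real \<Rightarrow> (real ^ 'm) \<times> real"
  assumes P: "P \<noteq> {}" "bounded P"
    and f: "linear f"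
    and transversal: "snd (f (0, 1)) \<noteq> 0"
    and K: "K = (\<lambda>x. f x + b) ` (P \<times> {0..})"
  shows "(\<exists>a. \<not> bounded (fibre K a)) \<or> \<not> bounded (frak_A K)"
proof (rule ccontr)
  assume "\<not> ?thesis"
  then have fib: "bounded (fibre K a)" and A: "bounded (frak_A K)" for a
    by auto
  obtain p where "p \<in> P"
    using P by blast
  define d where "d = f (0, 1)"
  have ray: "f (p, 0) + b + t *\<^sub>R d \<in> K" if "t \<ge> 0" for t
  proof -
    have "f (p, t) + b \<in> K"
      using \<open>p \<in> P\<close> that by (auto simp: K)
    then show ?thesis
      using linear_prod_line[OF f, of p t] by (simp add: d_def algebra_simps)
  qed
  have "fst d \<noteq> 0"
  proof
    assume "fst d = 0"
    then have "f (p, 0) + b + t *\<^sub>R d \<in> fibre K (fst (f (p, 0) + b))" if "t \<ge> 0" for t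
      using ray[OF that] by (simp add: fibre_def proj_n_def)
    from bounded_contains_ray_imp[OF fib this] show False
      using transversal by (simp add: d_def)
  qed
  have "linear (\<lambda>x. snd (f x))"
    using linear_compose[OF f linear_snd] by (simp add: comp_def)
  then have "bounded {x \<in> P \<times> UNIV. snd (f x) = - snd b}" (is "bounded ?S")
    using bounded_transversal_section transversal P by blast
  then have "bounded (fst ` (+) b ` f ` ?S)"
    using f by (intro bounded_fst bounded_translation bounded_linear_image)
      (simp_all add: linear_conv_bounded_linear)
  moreover have "{a. (a, 0) \<in> K} \<subseteq> fst ` (+) b ` f ` ?S"
  proof
    fix a
    assume "a \<in> {a. (a, 0) \<in> K}"
    then obtain x where x: "x \<in> P \<times> {0..}" "(a, 0) = f x + b"
      by (auto simp: K)
    have "snd (f x) + snd b = 0"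
      using arg_cong[OF x(2), of snd] unfolding snd_add snd_conv by (rule sym)
    then have "snd (f x) = - snd b"
      by (rule eq_neg_iff_add_eq_0[THEN iffD2])
    then have "x \<in> ?S"
      using x by auto
    moreover have "a = fst (b + f x)"
      using arg_cong[OF x(2), of fst] by simp
    ultimately show "a \<in> fst ` (+) b ` f ` ?S"
      by blast
  qed
  ultimately have "bounded (frak_A K \<union> {a. (a, 0) \<in> K})"
    using A bounded_subset by auto
  moreover have "fst ` K \<subseteq> frak_A K \<union> {a. (a, 0) \<in> K}"
    using mem_frak_A_iff by blast
  ultimately have "bounded (fst ` K)"
    using bounded_subset by blast
  moreover have "fst (f (p, 0) + b) + t *\<^sub>R fst d \<in> fst ` K" if "t \<ge> 0" for t
    using imageI[OF ray[OF that], of fst] by simp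
  ultimately show False
    using bounded_contains_ray_imp \<open>fst d \<noteq> 0\<close> by blast
qed

theorem corollaryA2:
  fixes n :: nat
    and P :: "(real ^ 'm::{finite,linorder}) set"
    and K :: "((real ^ 'm::{finite,linorder}) \<times> real) set"
  assumes "n \<ge> 4" and "CARD('m) = n - 1"
    and "polyhedron P" and "bounded P" and "without_sectional_projections P"
    and "K = P \<times> {0..}"
  shows "(\<forall>F. F facet_of K \<longrightarrow> \<not> can_be_placed_first K F) \<and>
         (\<forall>F. F facet_of K \<and> \<not> bounded F \<longrightarrow> \<not> can_be_placed_second K F)"
proof (intro conjI allI impI notI)
  fix F
  assume "can_be_placed_first K F"
  then obtain \<phi> where \<phi>: "affine_bijection \<phi>" "first_trimming_position (\<phi> ` K) (\<phi> ` F)"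
    by (auto simp: can_be_placed_first_def)
  obtain f b where f: "linear f" "bij f" "\<phi> = (\<lambda>x. f x + b)"
    using \<phi>(1) by (rule affine_bijectionE)
  have \<phi>K: "\<phi> ` K = (\<lambda>x. f x + b) ` (P \<times> {0..})"
    using f(3) assms(6) by simp
  have fib: "\<forall>a. bounded (fibre (\<phi> ` K) a)" and A: "bounded (frak_A (\<phi> ` K))"
    using \<phi>(2) by (auto simp: first_trimming_position_def)
  show False
  proof (cases "snd (f (0, 1)) = 0")
    case True
    from unbounded_frak_A_if_parallel[OF assms(5) f(1,2) this, of b] A show False
      by (simp add: \<phi>K)
  next
    case False
    from fibre_unbounded_or_frak_A_unbounded[OF _ assms(4) f(1) this \<phi>K]
      without_sectional_projections_imp_nonempty[OF assms(5)] fib A show False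
      by simp
  qed
next
  fix F
  assume F: "F facet_of K \<and> \<not> bounded F" and "can_be_placed_second K F"
  then obtain \<phi> where \<phi>: "affine_bijection \<phi>" "second_trimming_position (\<phi> ` K) (\<phi> ` F)"
    by (auto simp: can_be_placed_second_def)
  obtain f b where f: "linear f" "bij f" "\<phi> = (\<lambda>x. f x + b)"
    using \<phi>(1) by (rule affine_bijectionE)
  have A: "bounded (frak_A (\<phi> ` K))" and plane: "\<phi> ` F \<subseteq> {x. coord_n x = 0}"
    using \<phi>(2) by (auto simp: second_trimming_position_def)
  have "F \<subseteq> K"
    using F facet_of_imp_subset by blast
  \<comment> \<open>Pulled back by the placing map, the hyperplane cuts the cylinder in a set
    containing \<open>F\<close>. A transversal cut would be bounded, so unboundedness of
    \<open>F\<close> forces the parallel case.\<close>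
  then have "F \<subseteq> {x \<in> P \<times> UNIV. snd (f x) = - snd b}"
    using plane f(3) assms(6) by (auto simp: coord_n_def image_subset_iff eq_neg_iff_add_eq_0)
  moreover have "linear (\<lambda>x. snd (f x))"
    using linear_compose[OF f(1) linear_snd] by (simp add: comp_def)
  ultimately have "snd (f (0, 1)) = 0"
    using F bounded_transversal_section[of "\<lambda>x. snd (f x)" P] \<open>bounded P\<close> bounded_subset by blast
  from unbounded_frak_A_if_parallel[OF assms(5) f(1,2) this, of b] A show False
    by (simp add: f(3) assms(6))
qed

end
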